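(* Let $F:\mathbb{R}^2\times\mathbb{R}\to\mathbb{R}$, $(x,y,\alpha)\mapsto F(x,y,\alpha)$, be of class $\mathcal{C}^2$, and let $f:U\to\mathbb{R}$ be of class $\mathcal{C}^2$ on an open set $U\subset\mathbb{R}^2$ with $F(x,f(x,\alpha),\alpha)=0$ for all $(x,\alpha)\in U$. (1) Let $k\ge1$ and let $(x,\alpha)$ be such that the iterates $f^{j}=f^{j}(x,\alpha)$, $0\le j\le k$, are defined (that is, $(f^j,\alpha)\in U$ for $0\le j\le k-1$), with $F_y^{j}\ne0$ and $F_x^{j}\neq 0$ for $0\le j\le k-1$. Then at $(x,\alpha)$ $$\partial_{x^2}f^{k}=\partial_x f^{k}\sum_{j=0}^{k-1}\frac{F_{x^2}^{j}-2F_{xy}^{j}\nu_j+F_{y^2}^{j}\nu_j^2}{F_x^{j}}\,\partial_x f^{j}.$$ (2) Let $x_0$ be a periodic point of period $p\ge 1$ of $f(\cdot,\alpha)$, with orbit $x_j=f^j(x_0,\alpha)$, $(x_j,\alpha)\in U$ for $0\le j\le p-1$, $x_p=x_0$, $F_y(x_j,x_{j+1},\alpha)\neq0$ for $0\le j\le p-1$, and $\partial_x f^{p}(x_0,\alpha)=\varepsilon$ with $\varepsilon\in\{1,-1\}$. Then $$\partial_{x^2}f^{p}(x_0,\alpha)=\varepsilon\sum_{j=0}^{p-1}\frac{\widetilde F_{x^2}^{j}-2\widetilde F_{xy}^{j}\widetilde\nu_j+\widetilde F_{y^2}^{j}\widetilde\nu_j^2}{\widetilde F_x^{j}}\,\partial_x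 f^{j}(x_0,\alpha).$$
   Context: The equation $F(x_n,x_{n+1},\alpha)=0$ defines implicitly a one-dimensional discrete dynamical system $x_{n+1}=f(x_n,\alpha)$, where $\alpha$ is a real parameter. $f^{i}$ denotes the $i$-fold composition of $f$ in the dynamic variable with the parameter fixed: $f^{0}(x,\alpha)=x$, $f^{i+1}(x,\alpha)=f(f^{i}(x,\alpha),\alpha)$. Subscripts on $F$ denote partial derivatives with respect to its first argument $x$ and second argument $y$ ($F_{x^2}=F_{xx}$, $F_{y^2}=F_{yy}$). $F_x^{j}$, $F_y^{j}$, $F_{x^2}^{j}$, $F_{xy}^{j}$, $F_{y^2}^{j}$ denote these derivatives evaluated at $(f^{j}(x,\alpha),f^{j+1}(x,\alpha),\alpha)$ (the superscript $j$ is an index; $\nu_j^2$ is an ordinary power), and $\widetilde F_x^{j}$ etc. denote them evaluated at $(x_j,x_{j+1},\alpha)$; $\nu_j=F_x^{j}/F_y^{j}$ and $\widetilde\nu_j=\widetilde F_x^{j}/\widetilde F_y^{j}$. $\partial_x f^{j}$, $\partial_{x^2}f^{j}$ are the first and second partial derivatives of $(x,\alpha)\mapsto f^{j}(x,\alpha)$ with respect to $x$ (so $\partial_x f^{0}=1$). In (2) the quantities $\widetilde F_x^j$ are automatically nonzero, since $\partial_xf^p(x_0,\alpha)=\pm1$. *)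

theory Defs
  imports "HOL-Analysis.Analysis"
begin

text \<open>Class \<open>C\<^sup>n\<close> on an open set: all iterated directional derivatives up to order \<open>n\<close> exist as
  Frechet derivatives and are continuous. Intended for open \<open>S\<close> only, since \<open>at p\<close> looks at a
  full neighbourhood of \<open>p\<close>.\<close>

primrec C_class_on :: "nat \<Rightarrow> ('a::real_normed_vector \<Rightarrow> real) \<Rightarrow> 'a set \<Rightarrow> bool" where
  "C_class_on 0 g S \<longleftrightarrow> continuous_on S g"
| "C_class_on (Suc n) g S \<longleftrightarrow>
     (\<forall>p\<in>S. g differentiable (at p)) \<and>
     (\<forall>v. C_class_on n (\<lambda>p. frechet_derivative g (at p) v) S)"

definition D1 :: "(real \<Rightarrow> real \<Rightarrow> real \<Rightarrow> real) \<Rightarrow> real \<Rightarrow> real \<Rightarrow> real \<Rightarrow> real" where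
  "D1 G x y \<alpha> = deriv (\<lambda>t. G t y \<alpha>) x"

definition D2 :: "(real \<Rightarrow> real \<Rightarrow> real \<Rightarrow> real) \<Rightarrow> real \<Rightarrow> real \<Rightarrow> real \<Rightarrow> real" where
  "D2 G x y \<alpha> = deriv (\<lambda>t. G x t \<alpha>) y"

text \<open>A map \<open>f\<close> defined on \<open>U\<close> only is represented by a total function. The value
  \<open>iter f j x \<alpha>\<close> is meaningful when \<open>(iter f i x \<alpha>, \<alpha>) \<in> U\<close> for all \<open>i < j\<close>; if \<open>U\<close> is open
  and \<open>f\<close> is continuous on \<open>U\<close>, this then also holds for all points near \<open>(x, \<alpha>)\<close>, so the
  derivatives below do not depend on the values of \<open>f\<close> outside \<open>U\<close>.\<close>

definition iter :: "(real \<Rightarrow> real \<Rightarrow> real) \<Rightarrow> nat \<Rightarrow> real \<Rightarrow> real \<Rightarrow> real" where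
  "iter f j x \<alpha> = ((\<lambda>t. f t \<alpha>) ^^ j) x"

definition dx_iter :: "(real \<Rightarrow> real \<Rightarrow> real) \<Rightarrow> nat \<Rightarrow> real \<Rightarrow> real \<Rightarrow> real" where
  "dx_iter f j x \<alpha> = deriv (\<lambda>t. iter f j t \<alpha>) x"

definition dxx_iter :: "(real \<Rightarrow> real \<Rightarrow> real) \<Rightarrow> nat \<Rightarrow> real \<Rightarrow> real \<Rightarrow> real" where
  "dxx_iter f j x \<alpha> = deriv (\<lambda>t. dx_iter f j t \<alpha>) x"

text \<open>\<open>along G xs \<alpha> j\<close> is \<open>G\<^sup>j\<close>, i.e. \<open>G\<close> at \<open>(x\<^sub>j, x\<^sub>j\<^sub>+\<^sub>1, \<alpha>)\<close>.\<close>

definition along :: "(real \<Rightarrow> real \<Rightarrow> real \<Rightarrow> real) \<Rightarrow> (nat \<Rightarrow> real) \<Rightarrow> real \<Rightarrow> nat \<Rightarrow> real" where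
  "along G xs \<alpha> j = G (xs j) (xs (Suc j)) \<alpha>"

definition \<nu> :: "(real \<Rightarrow> real \<Rightarrow> real \<Rightarrow> real) \<Rightarrow> (nat \<Rightarrow> real) \<Rightarrow> real \<Rightarrow> nat \<Rightarrow> real" where
  "\<nu> F xs \<alpha> j = along (D1 F) xs \<alpha> j / along (D2 F) xs \<alpha> j"

text \<open>The mixed derivative \<open>F\<^sub>x\<^sub>y\<close> is \<open>D2 (D1 F)\<close>.\<close>

definition summand :: "(real \<Rightarrow> real \<Rightarrow> real \<Rightarrow> real) \<Rightarrow> (nat \<Rightarrow> real) \<Rightarrow> real \<Rightarrow> nat \<Rightarrow> real" where
  "summand F xs \<alpha> j =
     (along (D1 (D1 F)) xs \<alpha> j
       - 2 * along (D2 (D1 F)) xs \<alpha> j * \<nu> F xs \<alpha> j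
       + along (D2 (D2 F)) xs \<alpha> j * (\<nu> F xs \<alpha> j)\<^sup>2)
     / along (D1 F) xs \<alpha> j"

end

theory Submission
  imports Defs
begin

text \<open>Fix \<open>\<alpha>\<close> and write \<open>\<phi> t = f t \<alpha>\<close>. Differentiating \<open>F t (\<phi> t) \<alpha> = 0\<close> once gives
  \<open>\<phi>' = -F\<^sub>x / F\<^sub>y = -\<nu>\<close>; differentiating again, and using \<open>F\<^sub>x\<^sub>y = F\<^sub>y\<^sub>x\<close>, gives
  \<open>F\<^sub>y \<phi>'' = -(F\<^sub>x\<^sub>x - 2 F\<^sub>x\<^sub>y \<nu> + F\<^sub>y\<^sub>y \<nu>\<^sup>2)\<close>. Since \<open>-1 / F\<^sub>y = \<phi>' / F\<^sub>x\<close>, this says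
  that \<open>\<phi>'' = \<phi>' S\<close> at each point of the orbit, where \<open>S\<close> is the quotient that appears in the sum
  (\<open>implicit_second_derivative\<close>).

  So \<open>S\<close> is the logarithmic derivative of \<open>\<phi>'\<close>. By the chain rule the derivative of \<open>\<phi>\<^sup>k\<close> is the
  product of the \<open>\<phi>' (\<phi>\<^sup>j t)\<close> over \<open>j < k\<close>, and the logarithmic derivative of that
  product is the sum of the \<open>S\<^sub>j \<cdot> (\<phi>\<^sup>j)'\<close>, which is the claimed formula
  (\<open>funpow_second_derivative\<close>). Deriving it from the product rule instead of
  from logarithms covers negative values of \<open>\<phi>'\<close> as well.

  In the periodic case the product of the \<open>\<phi>' (x\<^sub>j)\<close> is \<open>\<epsilon> \<noteq> 0\<close>; hence every factor, and with
  it every \<open>F\<^sub>x\<close> along the orbit, is nonzero, and the first part applies with \<open>k = p\<close>.\<close>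

section \<open>Symmetry of mixed partial derivatives\<close>

text \<open>The mean value theorem, applied in one variable and then in the other, turns the second
  difference of \<open>g\<close> over a square into a value of the mixed derivative at a point of the square.
  The second difference is symmetric in the two variables, so both orders of differentiation can
  be compared through it.\<close>

lemma second_difference_eq_mixed_partial:
  fixes g gx gxy :: "real \<Rightarrow> real \<Rightarrow> real"
  assumes gx: "\<And>s t. ((\<lambda>s. g s t) has_real_derivative gx s t) (at s)"
    and gxy: "\<And>s t. (gx s has_real_derivative gxy s t) (at t)"
    and h: "h > 0"
  obtains \<xi> \<eta> where "x < \<xi>" "\<xi> < x + h" "y < \<eta>" "\<eta> < y + h"
    "g (x + h) (y + h) - g (x + h) y - g x (y + h) + g x y = h\<^sup>2 * gxy \<xi> \<eta>"
proof -
  have "\<exists>\<xi>. x < \<xi> \<and> \<xi> < x + h \<and>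
      (g (x + h) (y + h) - g (x + h) y) - (g x (y + h) - g x y)
        = (x + h - x) * (gx \<xi> (y + h) - gx \<xi> y)"
    using h by (intro MVT2) (auto intro!: DERIV_diff gx)
  then obtain \<xi> where \<xi>: "x < \<xi>" "\<xi> < x + h"
      "(g (x + h) (y + h) - g (x + h) y) - (g x (y + h) - g x y) = h * (gx \<xi> (y + h) - gx \<xi> y)"
    by auto
  have "\<exists>\<eta>. y < \<eta> \<and> \<eta> < y + h \<and> gx \<xi> (y + h) - gx \<xi> y = (y + h - y) * gxy \<xi> \<eta>"
    using h by (intro MVT2) (auto intro!: gxy)
  then obtain \<eta> where "y < \<eta>" "\<eta> < y + h" "gx \<xi> (y + h) - gx \<xi> y = h * gxy \<xi> \<eta>"
    by auto
  with \<xi> that show ?thesis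
    by (simp add: power2_eq_square)
qed

lemma mixed_partials_eq:
  fixes g gx gy gxy gyx :: "real \<Rightarrow> real \<Rightarrow> real"
  assumes gx: "\<And>s t. ((\<lambda>s. g s t) has_real_derivative gx s t) (at s)"
    and gy: "\<And>s t. (g s has_real_derivative gy s t) (at t)"
    and gxy: "\<And>s t. (gx s has_real_derivative gxy s t) (at t)"
    and gyx: "\<And>s t. ((\<lambda>s. gy s t) has_real_derivative gyx s t) (at s)"
    and cont_xy: "isCont (\<lambda>(s, t). gxy s t) (x, y)"
    and cont_yx: "isCont (\<lambda>(s, t). gyx s t) (x, y)"
  shows "gxy x y = gyx x y"
proof (rule ccontr)
  assume "gxy x y \<noteq> gyx x y"
  define e where "e = \<bar>gxy x y - gyx x y\<bar> / 2"
  have "e > 0"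
    using \<open>gxy x y \<noteq> gyx x y\<close> by (simp add: e_def)
  obtain d1 where d1: "d1 > 0"
      "\<And>s t. dist (s, t) (x, y) < d1 \<Longrightarrow> \<bar>gxy s t - gxy x y\<bar> < e"
    using cont_xy \<open>e > 0\<close> unfolding continuous_at_eps_delta by (fastforce simp: dist_real_def)
  obtain d2 where d2: "d2 > 0"
      "\<And>s t. dist (s, t) (x, y) < d2 \<Longrightarrow> \<bar>gyx s t - gyx x y\<bar> < e"
    using cont_yx \<open>e > 0\<close> unfolding continuous_at_eps_delta by (fastforce simp: dist_real_def)
  define h where "h = min d1 d2 / 2"
  have h: "h > 0" "2 * h \<le> d1" "2 * h \<le> d2"
    using d1 d2 by (auto simp: h_def)
  have near: "dist (s, t) (x, y) < 2 * h" if "x < s" "s < x + h" "y < t" "t < y + h" for s t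
  proof -
    have "dist (s, t) (x, y) \<le> \<bar>s - x\<bar> + \<bar>t - y\<bar>"
      by (simp add: dist_prod_def dist_real_def sqrt_sum_squares_le_sum_abs)
    with that show ?thesis by linarith
  qed
  obtain \<xi> \<eta> where P: "x < \<xi>" "\<xi> < x + h" "y < \<eta>" "\<eta> < y + h"
      "g (x + h) (y + h) - g (x + h) y - g x (y + h) + g x y = h\<^sup>2 * gxy \<xi> \<eta>"
    using second_difference_eq_mixed_partial[of g gx gxy h x y, OF gx gxy \<open>h > 0\<close>] by metis
  \<comment> \<open>the same with the roles of the variables exchanged\<close>
  obtain \<eta>' \<xi>' where Q: "y < \<eta>'" "\<eta>' < y + h" "x < \<xi>'" "\<xi>' < x + h"
      "g (x + h) (y + h) - g x (y + h) - g (x + h) y + g x y = h\<^sup>2 * gyx \<xi>' \<eta>'"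
    using second_difference_eq_mixed_partial
        [of "\<lambda>t s. g s t" "\<lambda>t s. gy s t" "\<lambda>t s. gyx s t" h y x, OF gy gyx \<open>h > 0\<close>] by metis
  have "h\<^sup>2 * gxy \<xi> \<eta> = h\<^sup>2 * gyx \<xi>' \<eta>'"
    using P(5) Q(5) by linarith
  then have "gxy \<xi> \<eta> = gyx \<xi>' \<eta>'"
    using h by simp
  moreover have "\<bar>gxy \<xi> \<eta> - gxy x y\<bar> < e"
    using d1(2) near[OF P(1-4)] h by (meson less_le_trans)
  moreover have "\<bar>gyx \<xi>' \<eta>' - gyx x y\<bar> < e"
    using d2(2) near[OF Q(3,4,1,2)] h by (meson less_le_trans)
  ultimately show False
    unfolding e_def by (auto simp: abs_if split: if_splits)
qed

section \<open>Partial derivatives of functions of class \<open>C\<^sup>n\<close>\<close>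

lemma has_derivative_imp_D1:
  assumes "((\<lambda>((x, y), \<alpha>). G x y \<alpha>) has_derivative G') (at ((x, y), \<alpha>))"
  shows "((\<lambda>t. G t y \<alpha>) has_real_derivative G' ((1, 0), 0)) (at x)"
proof -
  have "((\<lambda>t. ((t, y), \<alpha>)) has_derivative (\<lambda>h. ((h, 0), 0))) (at x)"
    by (intro has_derivative_Pair has_derivative_ident has_derivative_const)
  from has_derivative_compose[OF this assms]
  have "((\<lambda>t. G t y \<alpha>) has_derivative (\<lambda>h. G' ((h, 0), 0))) (at x)"
    by simp
  moreover have "(\<lambda>h. G' ((h, 0), 0)) = (*) (G' ((1, 0), 0))"
  proof
    show "G' ((h, 0), 0) = G' ((1, 0), 0) * h" for h
      using linear_scale[OF has_derivative_linear[OF assms], of h "((1, 0), 0)"] by simp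
  qed
  ultimately show ?thesis
    unfolding has_field_derivative_def by (rule has_derivative_eq_rhs)
qed

lemma has_derivative_imp_D2:
  assumes "((\<lambda>((x, y), \<alpha>). G x y \<alpha>) has_derivative G') (at ((x, y), \<alpha>))"
  shows "((\<lambda>t. G x t \<alpha>) has_real_derivative G' ((0, 1), 0)) (at y)"
proof -
  have "((\<lambda>t. ((x, t), \<alpha>)) has_derivative (\<lambda>h. ((0, h), 0))) (at y)"
    by (intro has_derivative_Pair has_derivative_ident has_derivative_const)
  from has_derivative_compose[OF this assms]
  have "((\<lambda>t. G x t \<alpha>) has_derivative (\<lambda>h. G' ((0, h), 0))) (at y)"
    by simp
  moreover have "(\<lambda>h. G' ((0, h), 0)) = (*) (G' ((0, 1), 0))"
  proof
    show "G' ((0, h), 0) = G' ((0, 1), 0) * h" for h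
      using linear_scale[OF has_derivative_linear[OF assms], of h "((0, 1), 0)"] by simp
  qed
  ultimately show ?thesis
    unfolding has_field_derivative_def by (rule has_derivative_eq_rhs)
qed

text \<open>The Frechet derivative is expressed through \<open>D1\<close> and \<open>D2\<close> in the first two directions only:
  its value in the direction of the parameter is left as it is, because the chain rule is used
  along curves on which \<open>\<alpha>\<close> is constant.\<close>

lemma C_class_on_partials:
  fixes G :: "real \<Rightarrow> real \<Rightarrow> real \<Rightarrow> real"
  assumes "C_class_on (Suc n) (\<lambda>((x, y), \<alpha>). G x y \<alpha>) UNIV"
  shows "C_class_on n (\<lambda>((x, y), \<alpha>). D1 G x y \<alpha>) UNIV"
    and "C_class_on n (\<lambda>((x, y), \<alpha>). D2 G x y \<alpha>) UNIV"
    and "((\<lambda>((x, y), \<alpha>). G x y \<alpha>) has_derivative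
           (\<lambda>((u, v), w). D1 G x y \<alpha> * u + D2 G x y \<alpha> * v
              + frechet_derivative (\<lambda>((x, y), \<alpha>). G x y \<alpha>) (at ((x, y), \<alpha>)) ((0, 0), w)))
          (at ((x, y), \<alpha>))"
    and "((\<lambda>t. G t y \<alpha>) has_real_derivative D1 G x y \<alpha>) (at x)"
    and "((\<lambda>t. G x t \<alpha>) has_real_derivative D2 G x y \<alpha>) (at y)"
proof -
  let ?G = "\<lambda>((x, y), \<alpha>). G x y \<alpha>"
  let ?G' = "\<lambda>x y \<alpha>. frechet_derivative ?G (at ((x, y), \<alpha>))"
  have G': "(?G has_derivative ?G' x y \<alpha>) (at ((x, y), \<alpha>))" for x y \<alpha>
    using assms by (simp add: frechet_derivative_works[symmetric])
  have D1: "D1 G x y \<alpha> = ?G' x y \<alpha> ((1, 0), 0)" for x y \<alpha>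
    unfolding D1_def by (intro DERIV_imp_deriv has_derivative_imp_D1 G')
  have D2: "D2 G x y \<alpha> = ?G' x y \<alpha> ((0, 1), 0)" for x y \<alpha>
    unfolding D2_def by (intro DERIV_imp_deriv has_derivative_imp_D2 G')
  have "(\<lambda>((x, y), \<alpha>). D1 G x y \<alpha>) = (\<lambda>p. frechet_derivative ?G (at p) ((1, 0), 0))"
    by (auto simp: D1)
  then show "C_class_on n (\<lambda>((x, y), \<alpha>). D1 G x y \<alpha>) UNIV"
    using assms by simp
  have "(\<lambda>((x, y), \<alpha>). D2 G x y \<alpha>) = (\<lambda>p. frechet_derivative ?G (at p) ((0, 1), 0))"
    by (auto simp: D2)
  then show "C_class_on n (\<lambda>((x, y), \<alpha>). D2 G x y \<alpha>) UNIV"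
    using assms by simp
  have lin: "linear (?G' x y \<alpha>)"
    by (rule has_derivative_linear[OF G'])
  have "?G' x y \<alpha> ((u, v), w) = D1 G x y \<alpha> * u + D2 G x y \<alpha> * v + ?G' x y \<alpha> ((0, 0), w)" for u v w
  proof -
    have "((u, v), w) = u *\<^sub>R ((1, 0), 0) + v *\<^sub>R ((0, 1), 0) + ((0::real, 0::real), w)"
      by simp
    then show ?thesis
      by (simp only: linear_add[OF lin] linear_scale[OF lin] D1 D2) (simp add: mult.commute)
  qed
  then have "?G' x y \<alpha> = (\<lambda>((u, v), w). D1 G x y \<alpha> * u + D2 G x y \<alpha> * v + ?G' x y \<alpha> ((0, 0), w))"
    unfolding fun_eq_iff split_paired_All prod.case by blast
  from has_derivative_eq_rhs[OF G' this] show "(?G has_derivative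
      (\<lambda>((u, v), w). D1 G x y \<alpha> * u + D2 G x y \<alpha> * v + ?G' x y \<alpha> ((0, 0), w))) (at ((x, y), \<alpha>))" .
  show "((\<lambda>t. G t y \<alpha>) has_real_derivative D1 G x y \<alpha>) (at x)"
    unfolding D1 by (intro has_derivative_imp_D1 G')
  show "((\<lambda>t. G x t \<alpha>) has_real_derivative D2 G x y \<alpha>) (at y)"
    unfolding D2 by (intro has_derivative_imp_D2 G')
qed

lemma DERIV_along_graph:
  fixes G :: "real \<Rightarrow> real \<Rightarrow> real \<Rightarrow> real"
  assumes G: "C_class_on (Suc n) (\<lambda>((x, y), \<alpha>). G x y \<alpha>) UNIV"
    and \<phi>: "(\<phi> has_real_derivative d) (at t)"
  shows "((\<lambda>s. G s (\<phi> s) \<alpha>) has_real_derivative D1 G t (\<phi> t) \<alpha> + D2 G t (\<phi> t) \<alpha> * d) (at t)"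
proof -
  have "((\<lambda>s. ((s, \<phi> s), \<alpha>)) has_derivative (\<lambda>h. ((h, d * h), 0))) (at t)"
    using \<phi> unfolding has_field_derivative_def
    by (intro has_derivative_Pair has_derivative_ident has_derivative_const)
  from has_derivative_compose[OF this C_class_on_partials(3)[OF G]]
  have along: "((\<lambda>s. G s (\<phi> s) \<alpha>) has_derivative
      (\<lambda>h. D1 G t (\<phi> t) \<alpha> * h + D2 G t (\<phi> t) \<alpha> * (d * h)
        + frechet_derivative (\<lambda>((x, y), \<alpha>). G x y \<alpha>) (at ((t, \<phi> t), \<alpha>)) 0)) (at t)"
    by (simp add: zero_prod_def)
  have "frechet_derivative (\<lambda>((x, y), \<alpha>). G x y \<alpha>) (at ((t, \<phi> t), \<alpha>)) 0 = 0"
    using G by (intro linear_0 linear_frechet_derivative) simp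
  then show ?thesis
    unfolding has_field_derivative_def
    by (intro has_derivative_eq_rhs[OF along]) (simp add: fun_eq_iff algebra_simps)
qed

lemma D1_D2_commute:
  assumes "C_class_on 2 (\<lambda>((x, y), \<alpha>). G x y \<alpha>) (UNIV :: ((real \<times> real) \<times> real) set)"
  shows "D1 (D2 G) x y \<alpha> = D2 (D1 G) x y \<alpha>"
proof -
  have G: "C_class_on (Suc (Suc 0)) (\<lambda>((x, y), \<alpha>). G x y \<alpha>) UNIV"
    using assms by (simp only: numeral_2_eq_2)
  have slice: "isCont (\<lambda>(s, t). H s t \<alpha>) (x, y)"
    if "C_class_on 0 (\<lambda>((x, y), \<alpha>). H x y \<alpha>) UNIV" for H :: "real \<Rightarrow> real \<Rightarrow> real \<Rightarrow> real"
  proof -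
    have "isCont (\<lambda>((x, y), \<alpha>). H x y \<alpha>) ((x, y), \<alpha>)"
      using that by (simp add: continuous_on_eq_continuous_at)
    moreover have "isCont (\<lambda>p. (p, \<alpha>)) (x, y)"
      by (intro continuous_intros)
    ultimately have "isCont (\<lambda>p. (\<lambda>((x, y), \<alpha>). H x y \<alpha>) (p, \<alpha>)) (x, y)"
      by (rule isCont_o2[rotated])
    then show ?thesis
      by (simp add: case_prod_unfold)
  qed
  have "D2 (D1 G) x y \<alpha> = D1 (D2 G) x y \<alpha>"
    by (rule mixed_partials_eq[of "\<lambda>x y. G x y \<alpha>" "\<lambda>x y. D1 G x y \<alpha>" "\<lambda>x y. D2 G x y \<alpha>"])
      (intro slice C_class_on_partials[OF G] C_class_on_partials[OF C_class_on_partials(1)[OF G]]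
        C_class_on_partials[OF C_class_on_partials(2)[OF G]])+
  then show ?thesis ..
qed

text \<open>Fixing \<open>\<alpha>\<close> reduces everything about \<open>f\<close> to one real variable. The second derivative at
  \<open>x\<close> needs the formula for the first one at all nearby points, hence the openness of \<open>U\<close>.\<close>

lemma C2_slice:
  fixes f :: "real \<Rightarrow> real \<Rightarrow> real"
  assumes f: "C_class_on 2 (\<lambda>(x, \<alpha>). f x \<alpha>) U"
    and U: "open U" and x: "(x, \<alpha>) \<in> U"
  shows "((\<lambda>s. f s \<alpha>) has_real_derivative deriv (\<lambda>s. f s \<alpha>) x) (at x)"
    and "(deriv (\<lambda>s. f s \<alpha>) has_real_derivative deriv (deriv (\<lambda>s. f s \<alpha>)) x) (at x)"
proof -
  have slice: "((\<lambda>s. g (s, \<alpha>)) has_real_derivative frechet_derivative g (at (t, \<alpha>)) (1, 0)) (at t)"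
    if "g differentiable (at (t, \<alpha>))" for g :: "real \<times> real \<Rightarrow> real" and t
  proof -
    have g: "(g has_derivative frechet_derivative g (at (t, \<alpha>))) (at (t, \<alpha>))"
      using that by (simp add: frechet_derivative_works)
    have "((\<lambda>s. (s, \<alpha>)) has_derivative (\<lambda>h. (h, 0))) (at t)"
      by (intro has_derivative_Pair has_derivative_ident has_derivative_const)
    from has_derivative_compose[OF this g]
    have "((\<lambda>s. g (s, \<alpha>)) has_derivative (\<lambda>h. frechet_derivative g (at (t, \<alpha>)) (h, 0))) (at t)" .
    moreover have "(\<lambda>h. frechet_derivative g (at (t, \<alpha>)) (h, 0))
        = (*) (frechet_derivative g (at (t, \<alpha>)) (1, 0))"
    proof
      show "frechet_derivative g (at (t, \<alpha>)) (h, 0)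
          = frechet_derivative g (at (t, \<alpha>)) (1, 0) * h" for h
        using linear_scale[OF has_derivative_linear[OF g], of h "(1, 0)"] by simp
    qed
    ultimately show ?thesis
      unfolding has_field_derivative_def by (rule has_derivative_eq_rhs)
  qed
  let ?f = "\<lambda>(x, \<alpha>). f x \<alpha>"
  let ?f' = "\<lambda>p. frechet_derivative ?f (at p) (1, 0)"
  let ?V = "(\<lambda>s. (s, \<alpha>)) -` U"
  have "C_class_on (Suc (Suc 0)) ?f U"
    using f by (simp only: numeral_2_eq_2)
  then have diff: "?f differentiable (at p)" "?f' differentiable (at p)" if "p \<in> U" for p
    using that by auto
  have V: "open ?V"
    by (rule open_vimage[OF U]) (intro continuous_intros)
  have f': "((\<lambda>s. f s \<alpha>) has_real_derivative ?f' (t, \<alpha>)) (at t)" if "t \<in> ?V" for t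
    using slice[OF diff(1), of t] that by simp
  then show "((\<lambda>s. f s \<alpha>) has_real_derivative deriv (\<lambda>s. f s \<alpha>) x) (at x)"
    using x by (metis DERIV_imp_deriv vimage_eq)
  have "(deriv (\<lambda>s. f s \<alpha>) has_real_derivative frechet_derivative ?f' (at (x, \<alpha>)) (1, 0)) (at x)"
  proof (rule has_field_derivative_transform_within_open[OF _ V])
    show "((\<lambda>s. ?f' (s, \<alpha>)) has_real_derivative frechet_derivative ?f' (at (x, \<alpha>)) (1, 0)) (at x)"
      by (rule slice[OF diff(2)[OF x]])
    show "x \<in> ?V"
      using x by simp
    show "?f' (s, \<alpha>) = deriv (\<lambda>s. f s \<alpha>) s" if "s \<in> ?V" for s
      using DERIV_imp_deriv[OF f'[OF that]] by simp
  qed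
  then show "(deriv (\<lambda>s. f s \<alpha>) has_real_derivative deriv (deriv (\<lambda>s. f s \<alpha>)) x) (at x)"
    using DERIV_imp_deriv by metis
qed

section \<open>Implicit differentiation\<close>

text \<open>Implicit differentiation, kept free of division: the equation between first derivatives holds
  on a neighbourhood of \<open>t\<close>, so it can be differentiated again at \<open>t\<close>.\<close>

lemma implicit_derivatives:
  fixes F :: "real \<Rightarrow> real \<Rightarrow> real \<Rightarrow> real"
  assumes F: "C_class_on 2 (\<lambda>((x, y), \<alpha>). F x y \<alpha>) (UNIV :: ((real \<times> real) \<times> real) set)"
    and V: "open V" "t \<in> V"
    and \<phi>': "\<And>s. s \<in> V \<Longrightarrow> (\<phi> has_real_derivative \<phi>' s) (at s)"
    and \<phi>'': "(\<phi>' has_real_derivative d) (at t)"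
    and zero: "\<And>s. s \<in> V \<Longrightarrow> F s (\<phi> s) \<alpha> = 0"
  shows "D1 F t (\<phi> t) \<alpha> + D2 F t (\<phi> t) \<alpha> * \<phi>' t = 0"
    and "D1 (D1 F) t (\<phi> t) \<alpha> + 2 * D2 (D1 F) t (\<phi> t) \<alpha> * \<phi>' t
      + D2 (D2 F) t (\<phi> t) \<alpha> * (\<phi>' t)\<^sup>2 + D2 F t (\<phi> t) \<alpha> * d = 0"
proof -
  have F': "C_class_on (Suc (Suc 0)) (\<lambda>((x, y), \<alpha>). F x y \<alpha>) UNIV"
    using F by (simp only: numeral_2_eq_2)
  have const: "D = 0" if "(h has_real_derivative D) (at s)" "\<And>s. s \<in> V \<Longrightarrow> h s = 0" "s \<in> V"
    for h :: "real \<Rightarrow> real" and D s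
    using has_field_derivative_transform_within_open[OF that(1) V(1) that(3), of "\<lambda>_. 0"] that(2)
      DERIV_unique[OF _ DERIV_const] by metis
  have first: "D1 F s (\<phi> s) \<alpha> + D2 F s (\<phi> s) \<alpha> * \<phi>' s = 0" if "s \<in> V" for s
    using DERIV_along_graph[OF F' \<phi>'[OF that]] zero that by (rule const)
  from first[OF V(2)] show "D1 F t (\<phi> t) \<alpha> + D2 F t (\<phi> t) \<alpha> * \<phi>' t = 0" .
  have "((\<lambda>s. D1 F s (\<phi> s) \<alpha> + D2 F s (\<phi> s) \<alpha> * \<phi>' s) has_real_derivative
      (D1 (D1 F) t (\<phi> t) \<alpha> + D2 (D1 F) t (\<phi> t) \<alpha> * \<phi>' t)
      + ((D1 (D2 F) t (\<phi> t) \<alpha> + D2 (D2 F) t (\<phi> t) \<alpha> * \<phi>' t) * \<phi>' t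
         + d * D2 F t (\<phi> t) \<alpha>)) (at t)"
    by (intro DERIV_add DERIV_mult \<phi>'' DERIV_along_graph[OF C_class_on_partials(1)[OF F']]
        DERIV_along_graph[OF C_class_on_partials(2)[OF F']] \<phi>' V)
  from const[OF this first V(2)]
  show "D1 (D1 F) t (\<phi> t) \<alpha> + 2 * D2 (D1 F) t (\<phi> t) \<alpha> * \<phi>' t
      + D2 (D2 F) t (\<phi> t) \<alpha> * (\<phi>' t)\<^sup>2 + D2 F t (\<phi> t) \<alpha> * d = 0"
    by (simp add: D1_D2_commute[OF F] power2_eq_square algebra_simps)
qed

text \<open>Solving the two equations of \<open>implicit_derivatives\<close> for the second derivative: here \<open>a\<close> and
  \<open>b\<close> stand for \<open>F\<^sub>x\<close> and \<open>F\<^sub>y\<close>, \<open>A\<close>, \<open>B\<close>, \<open>C\<close> for \<open>F\<^sub>x\<^sub>x\<close>, \<open>F\<^sub>x\<^sub>y\<close>, \<open>F\<^sub>y\<^sub>y\<close>, and \<open>u\<close>, \<open>v\<close>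
  for \<open>\<phi>'\<close>, \<open>\<phi>''\<close>. The factor \<open>u\<close> on the right comes from \<open>-1 / b = u / a\<close>.\<close>

lemma implicit_second_derivative:
  fixes a b A B C u v :: real
  assumes "a + b * u = 0" "A + 2 * B * u + C * u\<^sup>2 + b * v = 0" "a \<noteq> 0" "b \<noteq> 0"
  shows "v = u * ((A - 2 * B * (a / b) + C * (a / b)\<^sup>2) / a)"
proof -
  have u: "a / b = - u" "a = - b * u"
    using assms(1,4) by (auto simp: field_simps)
  have "u \<noteq> 0"
    using u(2) assms(3) by auto
  have "A - 2 * B * (a / b) + C * (a / b)\<^sup>2 = - b * v"
    using assms(2) by (simp add: u(1))
  then show ?thesis
    using u(2) \<open>u \<noteq> 0\<close> \<open>b \<noteq> 0\<close> by simp
qed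

section \<open>Derivatives of iterates\<close>

lemma DERIV_funpow:
  fixes \<phi> \<phi>' :: "real \<Rightarrow> real"
  assumes "\<And>j. j < k \<Longrightarrow> (\<phi> has_real_derivative \<phi>' ((\<phi> ^^ j) t)) (at ((\<phi> ^^ j) t))"
  shows "(\<phi> ^^ k has_real_derivative (\<Prod>j<k. \<phi>' ((\<phi> ^^ j) t))) (at t)"
  using assms
proof (induction k)
  case 0
  then show ?case by (simp add: id_def)
next
  case (Suc k)
  then have "(\<phi> \<circ> (\<phi> ^^ k) has_real_derivative
      \<phi>' ((\<phi> ^^ k) t) * (\<Prod>j<k. \<phi>' ((\<phi> ^^ j) t))) (at t)"
    by (intro DERIV_chain) auto
  then show ?case
    by (simp add: comp_def mult.commute)
qed

text \<open>\<open>S j\<close> is the logarithmic derivative of \<open>\<phi>'\<close> at the \<open>j\<close>-th orbit point. The product formula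
  for the derivative of an iterate holds not only at \<open>x\<close> but near \<open>x\<close>, because finitely many
  iterates stay in the open set \<open>V\<close>; it may therefore be differentiated again at \<open>x\<close>, and the
  logarithmic derivatives of the factors add up.\<close>

lemma funpow_second_derivative:
  fixes \<phi> \<phi>' :: "real \<Rightarrow> real"
  assumes V: "open V" and orbit: "\<And>j. j < k \<Longrightarrow> (\<phi> ^^ j) x \<in> V"
    and \<phi>': "\<And>t. t \<in> V \<Longrightarrow> (\<phi> has_real_derivative \<phi>' t) (at t)"
    and \<phi>'': "\<And>j. j < k \<Longrightarrow>
      (\<phi>' has_real_derivative \<phi>' ((\<phi> ^^ j) x) * S j) (at ((\<phi> ^^ j) x))"
  shows "deriv (deriv (\<phi> ^^ k)) x = deriv (\<phi> ^^ k) x * (\<Sum>j<k. S j * deriv (\<phi> ^^ j) x)"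
proof -
  let ?P = "\<lambda>k t. \<Prod>j<k. \<phi>' ((\<phi> ^^ j) t)"
  have P: "(\<phi> ^^ i has_real_derivative ?P i t) (at t)"
    if "\<And>j. j < i \<Longrightarrow> (\<phi> ^^ j) t \<in> V" for i t
    using that \<phi>' by (intro DERIV_funpow) auto
  have Px: "(\<phi> ^^ i has_real_derivative ?P i x) (at x)" if "i \<le> k" for i
    using that orbit by (intro P) auto
  have "\<forall>\<^sub>F t in nhds x. (\<phi> ^^ j) t \<in> V" if "j < k" for j
  proof -
    have "((\<phi> ^^ j) \<longlongrightarrow> (\<phi> ^^ j) x) (at x)"
      using DERIV_isCont[OF Px, of j] that by (simp add: isCont_def)
    from topological_tendstoD[OF this V orbit[OF that]] orbit[OF that] show ?thesis
      unfolding eventually_at_filter by (auto elim: eventually_mono)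
  qed
  then have "\<forall>\<^sub>F t in nhds x. \<forall>j\<in>{..<k}. (\<phi> ^^ j) t \<in> V"
    by (intro eventually_ball_finite) auto
  then have near: "\<forall>\<^sub>F t in nhds x. deriv (\<phi> ^^ k) t = ?P k t"
    by eventually_elim (intro DERIV_imp_deriv P, auto)
  have "(?P i has_real_derivative ?P i x * (\<Sum>j<i. S j * ?P j x)) (at x)" if "i \<le> k" for i
    using that
  proof (induction i)
    case 0
    then show ?case by simp
  next
    case (Suc i)
    have "((\<lambda>t. \<phi>' ((\<phi> ^^ i) t)) has_real_derivative \<phi>' ((\<phi> ^^ i) x) * S i * ?P i x) (at x)"
      using Suc.prems by (intro DERIV_chain2[OF \<phi>'' Px]) auto
    from DERIV_mult[OF Suc.IH this] Suc.prems show ?case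
      by (simp add: algebra_simps)
  qed
  from DERIV_imp_deriv[OF this[OF order_refl]]
  have "deriv (deriv (\<phi> ^^ k)) x = ?P k x * (\<Sum>j<k. S j * ?P j x)"
    using deriv_cong_ev[OF near refl] by simp
  also have "\<dots> = deriv (\<phi> ^^ k) x * (\<Sum>j<k. S j * deriv (\<phi> ^^ j) x)"
    using DERIV_imp_deriv[OF Px] by simp
  finally show ?thesis .
qed

section \<open>The second derivative of the iterates of an implicitly defined map\<close>

theorem proposition3p5:
  fixes F :: "real \<Rightarrow> real \<Rightarrow> real \<Rightarrow> real"
    and f :: "real \<Rightarrow> real \<Rightarrow> real"
    and U :: "(real \<times> real) set"
  assumes F_C2: "C_class_on 2 (\<lambda>((x, y), \<alpha>). F x y \<alpha>) (UNIV :: ((real \<times> real) \<times> real) set)"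
    and U_open: "open U"
    and f_C2: "C_class_on 2 (\<lambda>(x, \<alpha>). f x \<alpha>) U"
    and implicit: "\<forall>(x, \<alpha>)\<in>U. F x (f x \<alpha>) \<alpha> = 0"
  shows "(\<forall>k\<ge>1. \<forall>x \<alpha>.
            (\<forall>j<k. (iter f j x \<alpha>, \<alpha>) \<in> U) \<longrightarrow>
            (\<forall>j<k. along (D2 F) (\<lambda>i. iter f i x \<alpha>) \<alpha> j \<noteq> 0
                 \<and> along (D1 F) (\<lambda>i. iter f i x \<alpha>) \<alpha> j \<noteq> 0) \<longrightarrow>
            dxx_iter f k x \<alpha> =
              dx_iter f k x \<alpha> *
              (\<Sum>j<k. summand F (\<lambda>i. iter f i x \<alpha>) \<alpha> j * dx_iter f j x \<alpha>))
       \<and> (\<forall>p\<ge>1. \<forall>\<alpha> xs. \<forall>\<epsilon>\<in>{1, -1}.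
            (\<forall>j\<le>p. xs j = iter f j (xs 0) \<alpha>) \<longrightarrow>
            (\<forall>j<p. (xs j, \<alpha>) \<in> U) \<longrightarrow>
            xs p = xs 0 \<longrightarrow>
            (\<forall>j<p. D2 F (xs j) (xs (Suc j)) \<alpha> \<noteq> 0) \<longrightarrow>
            dx_iter f p (xs 0) \<alpha> = \<epsilon> \<longrightarrow>
            dxx_iter f p (xs 0) \<alpha> =
              \<epsilon> * (\<Sum>j<p. summand F xs \<alpha> j * dx_iter f j (xs 0) \<alpha>))"
proof -
  define V where "V \<alpha> = (\<lambda>s. (s, \<alpha>)) -` U" for \<alpha>
  define f' where "f' \<alpha> = deriv (\<lambda>s. f s \<alpha>)" for \<alpha>
  have V: "open (V \<alpha>)" for \<alpha>
    unfolding V_def by (rule open_vimage[OF U_open]) (intro continuous_intros)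
  have f': "((\<lambda>s. f s \<alpha>) has_real_derivative f' \<alpha> t) (at t)" if "t \<in> V \<alpha>" for t \<alpha>
    using C2_slice(1)[OF f_C2 U_open] that by (simp add: V_def f'_def)
  have f'': "(f' \<alpha> has_real_derivative deriv (f' \<alpha>) t) (at t)" if "t \<in> V \<alpha>" for t \<alpha>
    using C2_slice(2)[OF f_C2 U_open] that by (simp add: V_def f'_def)
  have zero: "F t (f t \<alpha>) \<alpha> = 0" if "t \<in> V \<alpha>" for t \<alpha>
    using implicit that by (auto simp: V_def)
  note implicit_eqs = implicit_derivatives[OF F_C2 V _ f' f'' zero]
  have iter_Suc: "iter f (Suc j) x \<alpha> = f (iter f j x \<alpha>) \<alpha>" for j x \<alpha>
    by (simp add: iter_def)
  have dx: "dx_iter f k x \<alpha> = deriv ((\<lambda>s. f s \<alpha>) ^^ k) x" for k x \<alpha>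
    by (simp add: dx_iter_def iter_def)

  have part1: "dxx_iter f k x \<alpha> =
      dx_iter f k x \<alpha> * (\<Sum>j<k. summand F (\<lambda>i. iter f i x \<alpha>) \<alpha> j * dx_iter f j x \<alpha>)"
    if orbit: "\<And>j. j < k \<Longrightarrow> (iter f j x \<alpha>, \<alpha>) \<in> U"
      and Fy: "\<And>j. j < k \<Longrightarrow> along (D2 F) (\<lambda>i. iter f i x \<alpha>) \<alpha> j \<noteq> 0"
      and Fx: "\<And>j. j < k \<Longrightarrow> along (D1 F) (\<lambda>i. iter f i x \<alpha>) \<alpha> j \<noteq> 0"
    for k x \<alpha>
  proof -
    have inV: "iter f j x \<alpha> \<in> V \<alpha>" if "j < k" for j
      using orbit[OF that] by (simp add: V_def)
    have "deriv (f' \<alpha>) (iter f j x \<alpha>)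
        = f' \<alpha> (iter f j x \<alpha>) * summand F (\<lambda>i. iter f i x \<alpha>) \<alpha> j" if "j < k" for j
      using implicit_eqs[OF inV[OF that] _ inV[OF that]] Fx[OF that] Fy[OF that]
      unfolding summand_def \<nu>_def along_def iter_Suc by (intro implicit_second_derivative)
    then have f''_orbit: "(f' \<alpha> has_real_derivative
        f' \<alpha> (iter f j x \<alpha>) * summand F (\<lambda>i. iter f i x \<alpha>) \<alpha> j) (at (iter f j x \<alpha>))" if "j < k" for j
      using f''[OF inV[OF that]] that by simp
    have "deriv (deriv ((\<lambda>s. f s \<alpha>) ^^ k)) x = deriv ((\<lambda>s. f s \<alpha>) ^^ k) x *
        (\<Sum>j<k. summand F (\<lambda>i. iter f i x \<alpha>) \<alpha> j * deriv ((\<lambda>s. f s \<alpha>) ^^ j) x)"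
      using inV f''_orbit by (intro funpow_second_derivative[OF V _ f']) (auto simp: iter_def)
    then show ?thesis
      by (simp add: dxx_iter_def dx)
  qed

  have part2: "dxx_iter f p (x0) \<alpha> = \<epsilon> * (\<Sum>j<p. summand F xs \<alpha> j * dx_iter f j (x0) \<alpha>)"
    if \<epsilon>: "\<epsilon> \<in> {1, -1}"
      and xs: "\<And>j. j \<le> p \<Longrightarrow> xs j = iter f j (x0) \<alpha>"
      and orbit: "\<And>j. j < p \<Longrightarrow> (xs j, \<alpha>) \<in> U"
      and Fy: "\<And>j. j < p \<Longrightarrow> D2 F (xs j) (xs (Suc j)) \<alpha> \<noteq> 0"
      and mult: "dx_iter f p (x0) \<alpha> = \<epsilon>"
    for p \<alpha> xs x0 and \<epsilon> :: real
  proof -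
    let ?ys = "\<lambda>i. iter f i (x0) \<alpha>"
    \<comment> \<open>Values of \<open>xs\<close> beyond index \<open>p\<close> are unconstrained, but only indices up to \<open>p\<close> occur.\<close>
    have along_eq: "along G ?ys \<alpha> j = along G xs \<alpha> j" if "j < p"
      for G :: "real \<Rightarrow> real \<Rightarrow> real \<Rightarrow> real" and j
      using that xs[of j] xs[of "Suc j"] by (simp add: along_def)
    have inV: "xs j \<in> V \<alpha>" if "j < p" for j
      using orbit[OF that] by (simp add: V_def)
    have "dx_iter f p (x0) \<alpha> = (\<Prod>j<p. f' \<alpha> (?ys j))"
      unfolding dx iter_def
      using inV xs by (intro DERIV_imp_deriv DERIV_funpow f') (auto simp: iter_def)
    \<comment> \<open>A multiplier \<open>\<plusminus>1\<close> keeps the orbit away from the critical points of \<open>f (\<cdot>, \<alpha>)\<close>.\<close>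
    with mult \<epsilon> have "(\<Prod>j<p. f' \<alpha> (?ys j)) \<noteq> 0"
      by auto
    then have f'_nz: "f' \<alpha> (xs j) \<noteq> 0" if "j < p" for j
      using that xs[of j] by simp
    have Fx: "along (D1 F) xs \<alpha> j \<noteq> 0" if "j < p" for j
    proof -
      have "xs (Suc j) = f (xs j) \<alpha>"
        using that xs[of j] xs[of "Suc j"] by (simp add: iter_Suc)
      then show ?thesis
        using implicit_eqs(1)[OF inV[OF that] _ inV[OF that]] Fy[OF that] f'_nz[OF that]
        by (auto simp: along_def)
    qed
    have "dxx_iter f p (x0) \<alpha> =
        dx_iter f p (x0) \<alpha> * (\<Sum>j<p. summand F ?ys \<alpha> j * dx_iter f j (x0) \<alpha>)"
    proof (rule part1)
      show "(iter f j (x0) \<alpha>, \<alpha>) \<in> U" if "j < p" for j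
        using orbit[OF that] xs[of j] that by simp
      show "along (D2 F) ?ys \<alpha> j \<noteq> 0" if "j < p" for j
      proof -
        have "along (D2 F) xs \<alpha> j \<noteq> 0"
          using Fy[OF that] by (simp add: along_def)
        then show ?thesis
          by (simp add: along_eq[OF that])
      qed
      show "along (D1 F) ?ys \<alpha> j \<noteq> 0" if "j < p" for j
        using Fx[OF that] along_eq[OF that] by simp
    qed
    moreover have "summand F ?ys \<alpha> j = summand F xs \<alpha> j" if "j < p" for j
      by (simp add: summand_def \<nu>_def along_eq[OF that])
    ultimately show ?thesis
      using mult by simp
  qed

  show ?thesis
  proof (intro conjI allI ballI impI)
    fix k :: nat and x \<alpha> :: real
    assume "\<forall>j<k. (iter f j x \<alpha>, \<alpha>) \<in> U"
      and "\<forall>j<k. along (D2 F) (\<lambda>i. iter f i x \<alpha>) \<alpha> j \<noteq> 0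
        \<and> along (D1 F) (\<lambda>i. iter f i x \<alpha>) \<alpha> j \<noteq> 0"
    then show "dxx_iter f k x \<alpha> =
        dx_iter f k x \<alpha> * (\<Sum>j<k. summand F (\<lambda>i. iter f i x \<alpha>) \<alpha> j * dx_iter f j x \<alpha>)"
      by (intro part1) blast+
  next
    fix p :: nat and \<alpha> \<epsilon> :: real and xs :: "nat \<Rightarrow> real"
    assume "\<epsilon> \<in> {1, -1}"
      and "\<forall>j\<le>p. xs j = iter f j (xs 0) \<alpha>"
      and "\<forall>j<p. (xs j, \<alpha>) \<in> U"
      and "\<forall>j<p. D2 F (xs j) (xs (Suc j)) \<alpha> \<noteq> 0"
      and "dx_iter f p (xs 0) \<alpha> = \<epsilon>"
    then show "dxx_iter f p (xs 0) \<alpha> = \<epsilon> * (\<Sum>j<p. summand F xs \<alpha> j * dx_iter f j (xs 0) \<alpha>)"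
      by (intro part2) blast+
  qed
qed

end
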